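(* For every positive integer $k$, there exist graphs $G$ and $H$ such that $$\gamma_k^{\mathrm L}(G\square H)=\left\lceil\frac{n(G)\,n(H)}{k+1}\right\rceil;$$ that is, the lower bound $\gamma_k^{\mathrm L}(G\square H)\ge\left\lceil\frac{n(G)\,n(H)}{k+1}\right\rceil$, valid for all graphs $G$ and $H$, is attained.
   Context: All graphs are finite and simple; $n(G)=|V(G)|$, and $N_G(u)$ is the open neighborhood of $u$ in $G$. A set $D\subseteq V(G)$ is a dominating set if every vertex of $V(G)\setminus D$ has a neighbor in $D$. For an integer $k\ge 0$, a dominating set $D$ of $G$ is a $k$-limited dominating set if $|N_G(u)\setminus D|\le k$ for every $u\in D$. The $k$-limited domination number $\gamma_k^{\mathrm L}(G)$ is the minimum cardinality of a $k$-limited dominating set of $G$ (defined for all integers $k\ge 0$). The Cartesian product $G\square H$ has vertex set $V(G)\times V(H)$, with $(g,h)$ and $(g',h')$ adjacent if and only if either $g=g'$ and $hh'\in E(H)$, or $h=h'$ and $gg'\in E(G)$. *)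

theory Defs
  imports Complex_Main "Graph_Theory.Pair_Digraph"
begin

text \<open>
  A finite simple graph is a pair_graph of the Graph_Theory entry: a finite, loop-free,
  symmetric digraph whose arcs are ordered pairs of vertices, so that an undirected edge
  uv is represented by the two arcs (u, v) and (v, u).
\<close>

definition nbhd :: "'a pair_pre_digraph \<Rightarrow> 'a \<Rightarrow> 'a set" where
  "nbhd G u = {v \<in> pverts G. (u, v) \<in> parcs G}"

definition dominating_set :: "'a pair_pre_digraph \<Rightarrow> 'a set \<Rightarrow> bool" where
  "dominating_set G D \<longleftrightarrow>
     D \<subseteq> pverts G \<and> (\<forall>v \<in> pverts G - D. \<exists>u \<in> D. u \<in> nbhd G v)"

definition limited_dominating_set :: "nat \<Rightarrow> 'a pair_pre_digraph \<Rightarrow> 'a set \<Rightarrow> bool" where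
  "limited_dominating_set k G D \<longleftrightarrow>
     dominating_set G D \<and> (\<forall>u \<in> D. card (nbhd G u - D) \<le> k)"

definition limited_domination_number :: "nat \<Rightarrow> 'a pair_pre_digraph \<Rightarrow> nat" where
  "limited_domination_number k G = Min (card ` {D. limited_dominating_set k G D})"

definition cartesian_product ::
    "'a pair_pre_digraph \<Rightarrow> 'b pair_pre_digraph \<Rightarrow> ('a \<times> 'b) pair_pre_digraph" where
  "cartesian_product G H =
     \<lparr> pverts = pverts G \<times> pverts H,
       parcs = {((g, h), (g', h')) | g h g' h'.
                  g \<in> pverts G \<and> g' \<in> pverts G \<and> h \<in> pverts H \<and> h' \<in> pverts H \<and>
                  (g = g' \<and> (h, h') \<in> parcs H \<or> h = h' \<and> (g, g') \<in> parcs G)} \<rparr>"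

text \<open>The minimum defining the domination number ranges over a finite nonempty set.\<close>

lemma limited_dominating_set_pverts: "limited_dominating_set k G (pverts G)"
proof -
  have outside: "nbhd G u - pverts G = {}" for u
    by (auto simp: nbhd_def)
  show ?thesis
    by (simp add: limited_dominating_set_def dominating_set_def outside)
qed

lemma finite_limited_dominating_sets:
  assumes "finite (pverts G)"
  shows "finite {D. limited_dominating_set k G D}"
  by (rule finite_subset[of _ "Pow (pverts G)"])
     (use assms in \<open>auto simp: limited_dominating_set_def dominating_set_def\<close>)

lemma pair_graph_cartesian_product:
  assumes "pair_graph G" "pair_graph H"
  shows "pair_graph (cartesian_product G H)"
proof -
  interpret G: pair_graph G by fact
  interpret H: pair_graph H by fact
  let ?P = "cartesian_product G H"
  have fin: "finite (pverts ?P)"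
    by (simp add: cartesian_product_def G.pair_finite_verts H.pair_finite_verts)
  have sub: "parcs ?P \<subseteq> pverts ?P \<times> pverts ?P"
    by (auto simp: cartesian_product_def)
  have fin_arcs: "finite (parcs ?P)"
    using sub fin by (meson finite_SigmaI finite_subset)
  have sym: "symmetric (with_proj ?P)"
    unfolding symmetric_def with_proj_simps
    by (rule symI) (auto simp: cartesian_product_def dest: G.arcs_symmetric H.arcs_symmetric)
  have loopfree: "fst e \<noteq> snd e" if "e \<in> parcs ?P" for e
    using that by (auto simp: cartesian_product_def dest: G.no_loops' H.no_loops')
  show ?thesis
    by unfold_locales (use fin sub fin_arcs sym loopfree in auto)
qed

end

theory Submission
  imports Defs
begin

text \<open>
  In a k-limited dominating set D, each vertex of D accounts for itself and at most k vertices
  outside D, so D has at least n / (k + 1) elements. If G is the complete graph on k + 1 vertices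
  and H is any graph, then a single fibre of H in the product is a k-limited dominating set with
  n(H) elements, so equality holds. Taking for H the complete graph on two vertices makes both
  factors nontrivial.
\<close>

lemma card_pverts_le_limited_dominating_set:
  assumes "pair_graph G" and D: "limited_dominating_set k G D"
  shows "card (pverts G) \<le> card D * (k + 1)"
proof -
  interpret pair_graph G by fact
  have "D \<subseteq> pverts G"
    using D by (simp add: limited_dominating_set_def dominating_set_def)
  then have "finite D"
    using pair_finite_verts by (rule finite_subset)
  have "pverts G \<subseteq> (\<Union>u\<in>D. insert u (nbhd G u - D))"
  proof
    fix v assume v: "v \<in> pverts G"
    show "v \<in> (\<Union>u\<in>D. insert u (nbhd G u - D))"
    proof (cases "v \<in> D")
      case False
      then obtain u where "u \<in> D" "(v, u) \<in> parcs G"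
        using D v unfolding limited_dominating_set_def dominating_set_def nbhd_def by blast
      \<comment> \<open>Domination yields the arc leaving \<open>v\<close>, whereas \<open>v\<close>
        is counted in \<open>nbhd G u\<close> through the arc leaving \<open>u\<close>; symmetry
        turns one into the other.\<close>
      moreover from this have "(u, v) \<in> parcs G"
        by (blast intro: arcs_symmetric)
      ultimately show ?thesis
        using v False by (auto simp: nbhd_def)
    qed blast
  qed
  moreover have "finite (\<Union>u\<in>D. insert u (nbhd G u - D))"
    using \<open>finite D\<close> pair_finite_verts by (auto simp: nbhd_def)
  ultimately have "card (pverts G) \<le> card (\<Union>u\<in>D. insert u (nbhd G u - D))"
    by (intro card_mono)
  also have "\<dots> \<le> (\<Sum>u\<in>D. card (insert u (nbhd G u - D)))"
    using \<open>finite D\<close> by (rule card_UN_le)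
  also have "\<dots> \<le> (\<Sum>u\<in>D. k + 1)"
  proof (rule sum_mono)
    fix u assume "u \<in> D"
    then have "card (nbhd G u - D) \<le> k"
      using D by (simp add: limited_dominating_set_def)
    then show "card (insert u (nbhd G u - D)) \<le> k + 1"
      using card_insert_le_m1[of "k + 1" "nbhd G u - D" u] by simp
  qed
  finally show ?thesis by simp
qed

lemma limited_domination_number_le:
  assumes "finite (pverts G)" "limited_dominating_set k G D"
  shows "limited_domination_number k G \<le> card D"
  unfolding limited_domination_number_def
  using assms finite_limited_dominating_sets[of G k] by (intro Min_le) auto

text \<open>A minimum over a finite set is a member of it once the set is nonempty, and the full
  vertex set is always a limited dominating set.\<close>

lemma limited_domination_number_attained:
  assumes "finite (pverts G)"
  obtains D where "limited_dominating_set k G D" "card D = limited_domination_number k G"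
proof -
  have "limited_domination_number k G \<in> card ` {D. limited_dominating_set k G D}"
    unfolding limited_domination_number_def
    using assms finite_limited_dominating_sets[of G k] limited_dominating_set_pverts[of k G]
    by (intro Min_in) auto
  then show ?thesis using that by auto
qed

lemma card_pverts_le_limited_domination_number:
  assumes "pair_graph G"
  shows "card (pverts G) \<le> limited_domination_number k G * (k + 1)"
proof -
  interpret pair_graph G by fact
  obtain D where "limited_dominating_set k G D" "card D = limited_domination_number k G"
    using pair_finite_verts by (rule limited_domination_number_attained)
  then show ?thesis
    using card_pverts_le_limited_dominating_set[OF assms] by metis
qed

lemma card_pverts_cartesian_product:
  "card (pverts (cartesian_product G H)) = card (pverts G) * card (pverts H)"
  by (simp add: cartesian_product_def card_cartesian_product)

lemma limited_domination_number_cartesian_product_ge: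
  assumes "pair_graph G" "pair_graph H"
  shows "\<lceil>real (card (pverts G)) * real (card (pverts H)) / real (k + 1)\<rceil>
           \<le> int (limited_domination_number k (cartesian_product G H))"
proof -
  have "card (pverts G) * card (pverts H)
          \<le> limited_domination_number k (cartesian_product G H) * (k + 1)"
    using card_pverts_le_limited_domination_number[OF pair_graph_cartesian_product[OF assms]]
    by (simp only: card_pverts_cartesian_product)
  then have "real (card (pverts G)) * real (card (pverts H))
          \<le> real (limited_domination_number k (cartesian_product G H)) * real (k + 1)"
    unfolding of_nat_mult[symmetric] of_nat_le_iff .
  then show ?thesis
    \<comment> \<open>An integer bounds a ceiling from above exactly when it bounds the number
      itself, so clearing the positive denominator \<open>k + 1\<close> leaves the counting
      inequality.\<close>
    by (simp add: ceiling_le_iff pos_divide_le_eq)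
qed

definition complete_graph :: "nat \<Rightarrow> nat pair_pre_digraph" where
  "complete_graph n = \<lparr> pverts = {..<n}, parcs = {(i, j). i < n \<and> j < n \<and> i \<noteq> j} \<rparr>"

lemma pverts_complete_graph [simp]: "pverts (complete_graph n) = {..<n}"
  by (simp add: complete_graph_def)

lemma pair_graph_complete_graph: "pair_graph (complete_graph n)"
proof -
  have "finite {(i, j). i < n \<and> j < n \<and> i \<noteq> j}"
    by (rule finite_subset[of _ "{..<n} \<times> {..<n}"]) auto
  then show ?thesis
    by unfold_locales (auto simp: complete_graph_def symmetric_def intro: symI)
qed

text \<open>For each \<open>h\<close>, the vertex \<open>(0, h)\<close> is adjacent to all others in
  the copy of the complete graph over \<open>h\<close>. Its neighbors in the H-direction stay in the
  fibre, so only the \<open>k\<close> others of that copy lie outside.\<close>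

lemma limited_dominating_set_fibre:
  assumes "pair_graph H"
  shows "limited_dominating_set k (cartesian_product (complete_graph (k + 1)) H) ({0} \<times> pverts H)"
    (is "limited_dominating_set k ?P ?D")
proof -
  have "\<exists>u \<in> ?D. u \<in> nbhd ?P v" if v: "v \<in> pverts ?P - ?D" for v
  proof (intro bexI)
    \<comment> \<open>The witness is the projection of \<open>v\<close> to the fibre: outside it the
      first coordinate of \<open>v\<close> is nonzero, hence adjacent to 0.\<close>
    show "(0, snd v) \<in> nbhd ?P v" "(0, snd v) \<in> ?D"
      using v by (auto simp: nbhd_def cartesian_product_def complete_graph_def)
  qed
  moreover have "card (nbhd ?P u - ?D) \<le> k" if u: "u \<in> ?D" for u
  proof -
    have "nbhd ?P u - ?D \<subseteq> {1..k} \<times> {snd u}"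
      using u by (auto simp: nbhd_def cartesian_product_def complete_graph_def)
    then have "card (nbhd ?P u - ?D) \<le> card ({1..k} \<times> {snd u})"
      by (intro card_mono) auto
    then show ?thesis by simp
  qed
  ultimately show ?thesis
    by (auto simp: limited_dominating_set_def dominating_set_def cartesian_product_def)
qed

lemma limited_domination_number_complete_graph_product:
  assumes "pair_graph H"
  shows "limited_domination_number k (cartesian_product (complete_graph (k + 1)) H)
           = card (pverts H)"
    (is "limited_domination_number k ?P = _")
proof (rule antisym)
  interpret P: pair_graph ?P
    using pair_graph_complete_graph assms by (rule pair_graph_cartesian_product)
  show "limited_domination_number k ?P \<le> card (pverts H)"
    using limited_domination_number_le[OF P.pair_finite_verts limited_dominating_set_fibre[OF assms]]
    by (simp add: card_cartesian_product)
  \<comment> \<open>The first factor has exactly \<open>k + 1\<close> vertices, so the counting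
    bound carries this factor on both sides and it cancels without rounding.\<close>
  have "(k + 1) * card (pverts H) \<le> (k + 1) * limited_domination_number k ?P"
    using card_pverts_le_limited_domination_number[OF P.pair_graph_axioms, of k]
    by (simp add: card_pverts_cartesian_product mult.commute)
  then show "card (pverts H) \<le> limited_domination_number k ?P"
    by (simp only: mult_le_cancel1)
qed

text \<open>The extremal graphs have natural numbers as vertices because \<open>'a\<close> may have
  fewer than \<open>k + 1\<close> elements. Nonemptiness rules out the degenerate equality 0 =
  0.\<close>

theorem corollary12:
  fixes k :: nat
  assumes "k \<ge> 1"
  shows "(\<forall>(G :: 'a pair_pre_digraph) (H :: 'b pair_pre_digraph).
            pair_graph G \<and> pair_graph H \<longrightarrow>
            int (limited_domination_number k (cartesian_product G H))
              \<ge> \<lceil>real (card (pverts G)) * real (card (pverts H)) / real (k + 1)\<rceil>) \<and>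
         (\<exists>(G :: nat pair_pre_digraph) (H :: nat pair_pre_digraph).
            pair_graph G \<and> pair_graph H \<and> pverts G \<noteq> {} \<and> pverts H \<noteq> {} \<and>
            int (limited_domination_number k (cartesian_product G H))
              = \<lceil>real (card (pverts G)) * real (card (pverts H)) / real (k + 1)\<rceil>)"
proof (intro conjI allI impI exI)
  fix G :: "'a pair_pre_digraph" and H :: "'b pair_pre_digraph"
  assume "pair_graph G \<and> pair_graph H"
  then show "int (limited_domination_number k (cartesian_product G H))
      \<ge> \<lceil>real (card (pverts G)) * real (card (pverts H)) / real (k + 1)\<rceil>"
    by (simp only: limited_domination_number_cartesian_product_ge)
next
  let ?G = "complete_graph (k + 1)" and ?H = "complete_graph 2"
  show "pair_graph ?G" "pair_graph ?H"
    by (rule pair_graph_complete_graph)+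
  show "pverts ?G \<noteq> {}" "pverts ?H \<noteq> {}"
    by (auto simp: lessThan_empty_iff)
  \<comment> \<open>The quotient is already an integer, so the ceiling does nothing and both sides
    equal 2, the order of the second factor.\<close>
  have quotient: "real (k + 1) * real 2 / real (k + 1) = real 2"
    by (rule nonzero_mult_div_cancel_left) simp
  show "int (limited_domination_number k (cartesian_product ?G ?H))
      = \<lceil>real (card (pverts ?G)) * real (card (pverts ?H)) / real (k + 1)\<rceil>"
    unfolding limited_domination_number_complete_graph_product[OF pair_graph_complete_graph]
      pverts_complete_graph card_lessThan quotient
    by simp
qed

end
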